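(* Let $t>1$ be an integer and $r=1$. Then an efficient $(t,1)$ broadcast domination pattern for the infinite king's lattice is given by placing towers at every vertex of the form \[v_{x,y}=(x(2t-1),\,y(2t-1)),\qquad x,y\in\mathbb Z .\]
   Context: The infinite king's lattice is the graph with vertex set $\mathbb Z^2$ in which each vertex is adjacent to its eight horizontal, vertical and diagonal neighbors; $d$ is its graph distance. For a set $\mathbb T$ of vertices (towers of strength $t$), the signal received by a vertex $v$ is $f(v)=\sum_{w\in\mathbb T}\max\{0,\,t-d(v,w)\}$ (a tower also receives its own signal). The placement $\mathbb T$ is a $(t,r)$ broadcast domination pattern if $f(v)\ge r$ for every vertex $v$. The broadcast zone of a tower $w$ is $\{v: d(v,w)\le t-1\}$, and the overlap is the set of vertices lying in the broadcast zones of more than one tower. The pattern is efficient if every vertex in the overlap receives signal exactly $r$. *)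

theory Defs
  imports "HOL-Analysis.Infinite_Sum"
begin

type_synonym vertex = "int \<times> int"

definition king_edges :: "(vertex \<times> vertex) set" where
  "king_edges = {((a, b), (c, d)). (a, b) \<noteq> (c, d) \<and> \<bar>a - c\<bar> \<le> 1 \<and> \<bar>b - d\<bar> \<le> 1}"

(* E ^^ n relates the endpoints of the walks with n edges.  The king's lattice is
   connected, so the LEAST below is always attained there. *)
definition graph_dist :: "('a \<times> 'a) set \<Rightarrow> 'a \<Rightarrow> 'a \<Rightarrow> nat" where
  "graph_dist E u v = (LEAST n. (u, v) \<in> E ^^ n)"

definition king_dist :: "vertex \<Rightarrow> vertex \<Rightarrow> nat" where
  "king_dist = graph_dist king_edges"

(* infsum rather than sum, because sum over an infinite tower set would be 0 by convention.
   Only the finitely many towers at distance less than t from v contribute a nonzero term. *)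
definition signal :: "int \<Rightarrow> vertex set \<Rightarrow> vertex \<Rightarrow> int" where
  "signal t T v = (\<Sum>\<^sub>\<infinity>w\<in>T. max 0 (t - int (king_dist v w)))"

definition broadcast_domination :: "int \<Rightarrow> int \<Rightarrow> vertex set \<Rightarrow> bool" where
  "broadcast_domination t r T \<longleftrightarrow> (\<forall>v. signal t T v \<ge> r)"

definition broadcast_zone :: "int \<Rightarrow> vertex \<Rightarrow> vertex set" where
  "broadcast_zone t w = {v. int (king_dist v w) \<le> t - 1}"

definition overlap :: "int \<Rightarrow> vertex set \<Rightarrow> vertex set" where
  "overlap t T = {v. \<exists>w\<in>T. \<exists>w'\<in>T. w \<noteq> w' \<and> v \<in> broadcast_zone t w \<and> v \<in> broadcast_zone t w'}"

definition efficient :: "int \<Rightarrow> int \<Rightarrow> vertex set \<Rightarrow> bool" where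
  "efficient t r T \<longleftrightarrow> (\<forall>v\<in>overlap t T. signal t T v = r)"

end

theory Submission
  imports Defs
begin

text \<open>
  The distance of the king's lattice is the Chebyshev distance, so broadcast zones are squares of
  side \<open>2 * t - 1\<close>, and the squares centred at the given towers tile the plane. Hence the overlap is
  empty, and every vertex receives a positive signal from the tower of its square.
\<close>

definition chebyshev :: "vertex \<Rightarrow> vertex \<Rightarrow> int" where
  "chebyshev u v = max \<bar>fst u - fst v\<bar> \<bar>snd u - snd v\<bar>"

text \<open>An edge changes each coordinate by at most 1, so each further edge raises the distance
  from \<open>u\<close> by at most 1.\<close>

lemma chebyshev_le_walk_length:
  "(u, v) \<in> king_edges ^^ n \<Longrightarrow> chebyshev u v \<le> int n"
proof (induction n arbitrary: v)
  case 0
  then show ?case by (simp add: chebyshev_def)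
next
  case (Suc n)
  then obtain w where "(u, w) \<in> king_edges ^^ n" and w: "(w, v) \<in> king_edges"
    by auto
  then have "chebyshev u w \<le> int n" using Suc.IH by blast
  with w show ?case
    by (auto simp: chebyshev_def king_edges_def)
qed

lemma walk_of_length_chebyshev:
  "chebyshev u v = int n \<Longrightarrow> (u, v) \<in> king_edges ^^ n"
proof (induction n arbitrary: v)
  case 0
  then show ?case by (auto simp: chebyshev_def prod_eq_iff)
next
  case (Suc n)
  \<comment> \<open>The walk is built backwards: \<open>w\<close> is \<open>v\<close> moved one step
    towards \<open>u\<close> in each coordinate where they differ, which lowers the maximum by
    exactly 1.\<close>
  define w where "w = (fst v + sgn (fst u - fst v), snd v + sgn (snd u - snd v))"
  have "chebyshev u w = int n"
    using Suc.prems by (auto simp: chebyshev_def w_def sgn_if)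
  then have "(u, w) \<in> king_edges ^^ n" by (rule Suc.IH)
  \<comment> \<open>Edges join distinct vertices; \<open>w\<close> differs from \<open>v\<close>
    because the distance \<open>Suc n\<close> is positive.\<close>
  moreover have "(w, v) \<in> king_edges"
    using Suc.prems by (cases v) (auto simp: chebyshev_def w_def king_edges_def sgn_if)
  ultimately show ?case by auto
qed

lemma king_dist_eq_chebyshev: "int (king_dist u v) = chebyshev u v"
proof -
  have nonneg: "chebyshev u v \<ge> 0" by (simp add: chebyshev_def)
  have "king_dist u v = nat (chebyshev u v)"
    unfolding king_dist_def graph_dist_def
  proof (rule Least_equality)
    show "(u, v) \<in> king_edges ^^ nat (chebyshev u v)"
      using nonneg by (intro walk_of_length_chebyshev) simp
  next
    fix n assume "(u, v) \<in> king_edges ^^ n"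
    then show "nat (chebyshev u v) \<le> n" using chebyshev_le_walk_length by fastforce
  qed
  with nonneg show ?thesis by simp
qed

text \<open>A window of radius \<open>t - 1\<close> holds \<open>2 * t - 1\<close> consecutive
  integers, exactly one period of the multiples.\<close>

lemma unique_multiple_near:
  fixes a t :: int
  assumes "t > 0"
  shows "\<exists>!x. \<bar>a - x * (2 * t - 1)\<bar> \<le> t - 1"
proof (rule ex_ex1I)
  define m where "m = 2 * t - 1"
  have "m > 0" using assms by (simp add: m_def)
  \<comment> \<open>Rounding to the nearest multiple: the shift by \<open>t - 1\<close> turns the
    remainder range from 0 to \<open>2 * t - 2\<close> into a deviation between
    \<open>-(t - 1)\<close> and \<open>t - 1\<close>.\<close>
  have "(a + t - 1) div m * m + (a + t - 1) mod m = a + t - 1" by simp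
  moreover have "0 \<le> (a + t - 1) mod m" "(a + t - 1) mod m < m" using \<open>m > 0\<close> by simp_all
  ultimately have "\<bar>a - (a + t - 1) div m * m\<bar> \<le> t - 1" unfolding m_def by linarith
  then show "\<exists>x. \<bar>a - x * (2 * t - 1)\<bar> \<le> t - 1" unfolding m_def by blast
next
  fix x y
  assume "\<bar>a - x * (2 * t - 1)\<bar> \<le> t - 1" "\<bar>a - y * (2 * t - 1)\<bar> \<le> t - 1"
  \<comment> \<open>By the triangle inequality the gap is at most \<open>2 * t - 2\<close>, less
    than one period.\<close>
  then have "\<bar>x * (2 * t - 1) - y * (2 * t - 1)\<bar> < 2 * t - 1" by linarith
  then have "\<bar>x - y\<bar> * (2 * t - 1) < 1 * (2 * t - 1)"
    using assms by (simp add: abs_mult flip: left_diff_distrib)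
  then show "x = y" using assms by (subst (asm) mult_less_cancel_right) auto
qed

text \<open>A Chebyshev ball is a product of intervals, so the two coordinates of the tower are
  determined independently.\<close>

lemma unique_tower_near:
  fixes t :: int
  assumes "t > 0"
  shows "\<exists>!w. w \<in> {(x * (2 * t - 1), y * (2 * t - 1)) | x y :: int. True} \<and> v \<in> broadcast_zone t w"
proof -
  obtain x where x: "\<bar>fst v - x * (2 * t - 1)\<bar> \<le> t - 1"
      "\<And>x'. \<bar>fst v - x' * (2 * t - 1)\<bar> \<le> t - 1 \<Longrightarrow> x' = x"
    using unique_multiple_near[OF assms, of "fst v"] by blast
  obtain y where y: "\<bar>snd v - y * (2 * t - 1)\<bar> \<le> t - 1"
      "\<And>y'. \<bar>snd v - y' * (2 * t - 1)\<bar> \<le> t - 1 \<Longrightarrow> y' = y"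
    using unique_multiple_near[OF assms, of "snd v"] by blast
  show ?thesis
  proof (rule ex1I[of _ "(x * (2 * t - 1), y * (2 * t - 1))"])
    show "(x * (2 * t - 1), y * (2 * t - 1)) \<in> {(x * (2 * t - 1), y * (2 * t - 1)) | x y. True}
        \<and> v \<in> broadcast_zone t (x * (2 * t - 1), y * (2 * t - 1))"
      using x(1) y(1) by (auto simp: broadcast_zone_def king_dist_eq_chebyshev chebyshev_def)
  next
    fix w
    assume "w \<in> {(x * (2 * t - 1), y * (2 * t - 1)) | x y. True} \<and> v \<in> broadcast_zone t w"
    then obtain x' y' where w: "w = (x' * (2 * t - 1), y' * (2 * t - 1))"
      and "v \<in> broadcast_zone t w"
      by blast
    then have "x' = x" "y' = y"
      using x(2) y(2) by (auto simp: broadcast_zone_def king_dist_eq_chebyshev chebyshev_def)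
    with w show "w = (x * (2 * t - 1), y * (2 * t - 1))" by simp
  qed
qed

lemma signal_pos:
  assumes "\<exists>!w. w \<in> T \<and> v \<in> broadcast_zone t w"
  shows "signal t T v \<ge> 1"
proof -
  obtain w where w: "w \<in> T" "v \<in> broadcast_zone t w"
    and unique: "\<And>w'. w' \<in> T \<Longrightarrow> v \<in> broadcast_zone t w' \<Longrightarrow> w' = w"
    using assms by blast
  have "signal t T v = (\<Sum>\<^sub>\<infinity>w'\<in>{w}. max 0 (t - int (king_dist v w')))"
    unfolding signal_def
  \<comment> \<open>Outside its zone a tower contributes 0, so the infinite sum collapses to the
    term of \<open>w\<close>.\<close>
  proof (rule infsum_cong_neutral)
    fix w' assume "w' \<in> T - {w}"
    then have "v \<notin> broadcast_zone t w'" using unique by blast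
    then show "max 0 (t - int (king_dist v w')) = 0" by (simp add: broadcast_zone_def)
  qed (use w in auto)
  also have "\<dots> = max 0 (t - int (king_dist v w))" by simp
  finally show ?thesis using w(2) by (simp add: broadcast_zone_def)
qed

theorem theorem5p4:
  fixes t r :: int and \<T> :: "vertex set"
  assumes "t > 1" and "r = 1"
    and "\<T> = {(x * (2 * t - 1), y * (2 * t - 1)) | x y :: int. True}"
  shows "broadcast_domination t r \<T> \<and> efficient t r \<T>"
proof -
  have unique: "\<exists>!w. w \<in> \<T> \<and> v \<in> broadcast_zone t w" for v
    using unique_tower_near[of t v] assms by simp
  then have "broadcast_domination t r \<T>"
    using signal_pos assms(2) by (simp add: broadcast_domination_def)
  \<comment> \<open>Existence of a covering tower gave domination; uniqueness now makes efficiency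
    vacuous.\<close>
  moreover have "overlap t \<T> = {}"
    using unique unfolding overlap_def by blast
  ultimately show ?thesis by (simp add: efficient_def)
qed

end
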